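(* Assume that the model operators $\mathcal{M}_{k,k+1}$ ($k=0,\dots,N-1$), the cost functions $r_k$ ($k=0,\dots,N$) and the initial-condition map $\theta\mapsto\mathbf{x}_0(\theta)$ are twice continuously differentiable, and that $\mathcal{E}:\mathbb{R}^m\to\mathbb{R}$ is continuously differentiable. Let $\theta^{\rm a}$ be a minimizer of the inverse problem and assume that the reduced Hessian $(\nabla^2_{\theta,\theta}j)(\theta^{\rm a})\in\mathbb{R}^{m\times m}$ is positive definite. Let $\mathbf{x}=\mathbf{x}(\theta^{\rm a})$ and $\lambda=\lambda(\theta^{\rm a})$ be the corresponding forward and adjoint solutions. Then the super-Lagrange multipliers $\zeta\in\mathbb{R}^m$, $\mu=(\mu_k)_{k=0}^N$, $\nu=(\nu_k)_{k=0}^N$ with $\mu_k,\nu_k\in\mathbb{R}^n$, for which $(\theta^{\rm a},\mathbf{x},\lambda,\mu,\nu,\zeta)$ is a stationary point of the super-Lagrangian $\mathcal{L}^{\mathcal{E}}$, are exactly those computed by the following steps. 1. Solve the linear system (Hessian equation) $$(\nabla^2_{\theta,\theta}j)(\theta^{\rm a})\,\zeta=\mathcal{E}_\theta^T,$$ with $\mathcal{E}_\theta$ evaluated at $\theta^{\rm a}$. 2. Solve the tangent linear model $$\mu_0=-(\mathbf{x}_0)_\theta\,\zeta,\qquad \mu_k=\mathbf{M}_{k-1,k}\,\mu_{k-1}-\mathfrak{M}_{k-1,k}\,\zeta,\quad k=1,\dots,N.$$ 3. Solve the second order adjoint model $$\nu_N=(r_N)_{\mathbf{x}_N,\mathbf{x}_N}\,\mu_N-(r_N)_{\theta,\mathbf{x}_N}\,\zeta,$$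 $$\nu_k=\mathbf{M}_{k,k+1}^T\nu_{k+1}+\bigl(\mathbf{M}_{k,k+1}^T\lambda_{k+1}\bigr)^T_{\mathbf{x}_k}\mu_k+(r_k)_{\mathbf{x}_k,\mathbf{x}_k}\,\mu_k-(r_k)_{\theta,\mathbf{x}_k}\,\zeta-\bigl(\mathfrak{M}_{k,k+1}^T\lambda_{k+1}\bigr)^T_{\mathbf{x}_k}\zeta,\quad k=N-1,\dots,0.$$
   Context: Fix integers $n,m,N\ge1$. Subscripts $\mathbf{x}$, $\theta$ denote partial derivatives (Jacobians); the derivative of a scalar function is a row vector. Model: $\mathbf{x}_{k+1}=\mathcal{M}_{k,k+1}(\mathbf{x}_k,\theta)$ for $k=0,\dots,N-1$, with $\mathbf{x}_0=\mathbf{x}_0(\theta)$, where $\mathbf{x}_k\in\mathbb{R}^n$, $\theta\in\mathbb{R}^m$, $\mathcal{M}_{k,k+1}:\mathbb{R}^n\times\mathbb{R}^m\to\mathbb{R}^n$. Its solution is denoted $\mathbf{x}_k(\theta)$. With $r_k:\mathbb{R}^n\times\mathbb{R}^m\to\mathbb{R}$, the reduced cost function is $j(\theta)=\sum_{k=0}^N r_k(\mathbf{x}_k(\theta),\theta)$. The inverse problem is to minimize $j$ over $\theta\in\mathbb{R}^m$. Write $\mathbf{M}_{k,k+1}=(\mathcal{M}_{k,k+1})_{\mathbf{x}}(\mathbf{x}_k,\theta)\in\mathbb{R}^{n\times n}$ and $\mathfrak{M}_{k,k+1}=(\mathcal{M}_{k,k+1})_\theta(\mathbf{x}_k,\theta)\in\mathbb{R}^{n\times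 m}$. Let $(r_k)_{\mathbf{x}_k}$, $(r_k)_\theta$ be the partial derivatives of $r_k$ at $(\mathbf{x}_k,\theta)$; $(r_k)_{\mathbf{x}_k,\mathbf{x}_k}\in\mathbb{R}^{n\times n}$ is the Hessian of $r_k$ in $\mathbf{x}$, and $(r_k)_{\theta,\mathbf{x}_k}\in\mathbb{R}^{n\times m}$ is the mixed second derivative matrix with $(i,l)$ entry $\partial^2 r_k/\partial \mathbf{x}^{(i)}\partial\theta^{(l)}$, where superscripts denote components. In $(\mathbf{M}_{k,k+1}^T\lambda_{k+1})_{\mathbf{x}_k}\in\mathbb{R}^{n\times n}$ and $(\mathfrak{M}_{k,k+1}^T\lambda_{k+1})_{\mathbf{x}_k}\in\mathbb{R}^{m\times n}$ the Jacobian is taken with respect to $\mathbf{x}_k$ with $\lambda_{k+1}$ held fixed. In the claim all these quantities are evaluated along $\theta^{\rm a}$, $\mathbf{x}_k(\theta^{\rm a})$, $\lambda_k(\theta^{\rm a})$. Adjoint solution $\lambda(\theta)=(\lambda_k)_{k=0}^N$, $\lambda_k\in\mathbb{R}^n$: $\lambda_N=(r_N)_{\mathbf{x}_N}^T$ and $\lambda_k=\mathbf{M}_{k,k+1}^T\lambda_{k+1}+(r_k)_{\mathbf{x}_k}^T$, $k=N-1,\dots,0$. Super-Lagrangian: for a functional $\mathcal{E}:\mathbb{R}^m\to\mathbb{R}$ and independent variables $\theta,\zeta\in\mathbb{R}^m$, $\mathbf{x}=(\mathbf{x}_k)_{k=0}^N$, $\lambda=(\lambda_k)_{k=0}^N$,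 $\mu=(\mu_k)_{k=0}^N$, $\nu=(\nu_k)_{k=0}^N$ in $(\mathbb{R}^n)^{N+1}$, $$\mathcal{L}^{\mathcal{E}}(\theta,\mathbf{x},\lambda,\mu,\nu,\zeta)=\mathcal{E}(\theta)-\nu_0^T\bigl(\mathbf{x}_0-\mathbf{x}_0(\theta)\bigr)-\sum_{k=0}^{N-1}\nu_{k+1}^T\bigl(\mathbf{x}_{k+1}-\mathcal{M}_{k,k+1}(\mathbf{x}_k,\theta)\bigr)-\mu_N^T\bigl(\lambda_N-(r_N)_{\mathbf{x}_N}^T\bigr)$$ $$-\sum_{k=0}^{N-1}\mu_k^T\bigl(\lambda_k-\mathbf{M}_{k,k+1}^T\lambda_{k+1}-(r_k)_{\mathbf{x}_k}^T\bigr)-\zeta^T\Bigl((\mathbf{x}_0)_\theta^T\lambda_0+\sum_{k=0}^N(r_k)_\theta^T+\sum_{k=0}^{N-1}\mathfrak{M}_{k,k+1}^T\lambda_{k+1}\Bigr),$$ where $(\mathbf{x}_0)_\theta$ denotes the Jacobian of the map $\theta\mapsto\mathbf{x}_0(\theta)$. A stationary point is a point where all first-order partial derivatives of $\mathcal{L}^{\mathcal{E}}$ with respect to $\theta,\mathbf{x},\lambda,\mu,\nu,\zeta$ vanish. *)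

theory Defs
  imports "HOL-Analysis.Analysis"
begin

definition C1 :: "('a::real_normed_vector \<Rightarrow> 'b::real_normed_vector) \<Rightarrow> bool" where
  "C1 f \<longleftrightarrow> (\<exists>f' :: 'a \<Rightarrow> 'a \<Rightarrow>\<^sub>L 'b.
     (\<forall>x. (f has_derivative blinfun_apply (f' x)) (at x)) \<and> continuous_on UNIV f')"

definition C2 :: "('a::real_normed_vector \<Rightarrow> 'b::real_normed_vector) \<Rightarrow> bool" where
  "C2 f \<longleftrightarrow> (\<exists>f' :: 'a \<Rightarrow> 'a \<Rightarrow>\<^sub>L 'b.
     (\<forall>x. (f has_derivative blinfun_apply (f' x)) (at x)) \<and> C1 f')"

text \<open>The gradient is a column vector, i.e. the transpose of the (row vector) derivative.\<close>

definition grad :: "(real^'a \<Rightarrow> real) \<Rightarrow> real^'a \<Rightarrow> real^'a" where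
  "grad f x = (\<chi> i. frechet_derivative f (at x) (axis i 1))"

definition hessian :: "(real^'a \<Rightarrow> real) \<Rightarrow> real^'a \<Rightarrow> real^'a^'a" where
  "hessian f x = jacobian (grad f) (at x)"

text \<open>Symmetry is not required here; it is automatic for the Hessian of a \<open>C2\<close> function.\<close>

definition positive_definite :: "real^'a^'a \<Rightarrow> bool" where
  "positive_definite A \<longleftrightarrow> (\<forall>v. v \<noteq> 0 \<longrightarrow> v \<bullet> (A *v v) > 0)"

definition partials_vanish :: "(real^'a \<Rightarrow> real) \<Rightarrow> real^'a \<Rightarrow> bool" where
  "partials_vanish f x \<longleftrightarrow>
     (\<forall>i. ((\<lambda>t. f (x + t *\<^sub>R axis i 1)) has_real_derivative 0) (at 0))"

text \<open>
  The map \<open>M k\<close> is the model operator from time \<open>k\<close> to time \<open>k + 1\<close>. The type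
  \<open>real^'m^'n\<close> is that of matrices with rows indexed by \<open>'n\<close> and columns by \<open>'m\<close>.
\<close>

definition model_x ::
  "(nat \<Rightarrow> (real^'n) \<times> (real^'m) \<Rightarrow> real^'n) \<Rightarrow> nat \<Rightarrow> real^'n \<Rightarrow> real^'m \<Rightarrow> real^'n^'n" where
  "model_x M k x \<theta> = jacobian (\<lambda>y. M k (y, \<theta>)) (at x)"

definition model_\<theta> ::
  "(nat \<Rightarrow> (real^'n) \<times> (real^'m) \<Rightarrow> real^'n) \<Rightarrow> nat \<Rightarrow> real^'n \<Rightarrow> real^'m \<Rightarrow> real^'m^'n" where
  "model_\<theta> M k x \<theta> = jacobian (\<lambda>t. M k (x, t)) (at \<theta>)"

definition cost_x ::
  "(nat \<Rightarrow> (real^'n) \<times> (real^'m) \<Rightarrow> real) \<Rightarrow> nat \<Rightarrow> real^'n \<Rightarrow> real^'m \<Rightarrow> real^'n" where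
  "cost_x r k x \<theta> = grad (\<lambda>y. r k (y, \<theta>)) x"

definition cost_\<theta> ::
  "(nat \<Rightarrow> (real^'n) \<times> (real^'m) \<Rightarrow> real) \<Rightarrow> nat \<Rightarrow> real^'n \<Rightarrow> real^'m \<Rightarrow> real^'m" where
  "cost_\<theta> r k x \<theta> = grad (\<lambda>t. r k (x, t)) \<theta>"

definition cost_xx ::
  "(nat \<Rightarrow> (real^'n) \<times> (real^'m) \<Rightarrow> real) \<Rightarrow> nat \<Rightarrow> real^'n \<Rightarrow> real^'m \<Rightarrow> real^'n^'n" where
  "cost_xx r k x \<theta> = hessian (\<lambda>y. r k (y, \<theta>)) x"

text \<open>
  Row \<open>i\<close>, column \<open>l\<close> of the mixed derivative is the derivative with respect to \<open>x $ i\<close> of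
  the derivative with respect to \<open>\<theta> $ l\<close>, hence the transpose.
\<close>

definition cost_\<theta>x ::
  "(nat \<Rightarrow> (real^'n) \<times> (real^'m) \<Rightarrow> real) \<Rightarrow> nat \<Rightarrow> real^'n \<Rightarrow> real^'m \<Rightarrow> real^'m^'n" where
  "cost_\<theta>x r k x \<theta> = transpose (jacobian (\<lambda>y. cost_\<theta> r k y \<theta>) (at x))"

definition model_x_adj_x ::
  "(nat \<Rightarrow> (real^'n) \<times> (real^'m) \<Rightarrow> real^'n) \<Rightarrow> nat \<Rightarrow> real^'n \<Rightarrow> real^'m \<Rightarrow> real^'n \<Rightarrow> real^'n^'n" where
  "model_x_adj_x M k x \<theta> l = jacobian (\<lambda>y. transpose (model_x M k y \<theta>) *v l) (at x)"

definition model_\<theta>_adj_x ::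
  "(nat \<Rightarrow> (real^'n) \<times> (real^'m) \<Rightarrow> real^'n) \<Rightarrow> nat \<Rightarrow> real^'n \<Rightarrow> real^'m \<Rightarrow> real^'n \<Rightarrow> real^'n^'m" where
  "model_\<theta>_adj_x M k x \<theta> l = jacobian (\<lambda>y. transpose (model_\<theta> M k y \<theta>) *v l) (at x)"

text \<open>
  Trajectories over the times \<open>0, \<dots>, N\<close> are functions on \<open>nat\<close> of which only the values at
  \<open>k \<le> N\<close> are meaningful.
\<close>

primrec forward ::
  "(nat \<Rightarrow> (real^'n) \<times> (real^'m) \<Rightarrow> real^'n) \<Rightarrow> (real^'m \<Rightarrow> real^'n) \<Rightarrow> real^'m \<Rightarrow> nat \<Rightarrow> real^'n" where
  "forward M x0 \<theta> 0 = x0 \<theta>"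
| "forward M x0 \<theta> (Suc k) = M k (forward M x0 \<theta> k, \<theta>)"

definition reduced_cost ::
  "nat \<Rightarrow> (nat \<Rightarrow> (real^'n) \<times> (real^'m) \<Rightarrow> real^'n) \<Rightarrow> (nat \<Rightarrow> (real^'n) \<times> (real^'m) \<Rightarrow> real)
    \<Rightarrow> (real^'m \<Rightarrow> real^'n) \<Rightarrow> real^'m \<Rightarrow> real" where
  "reduced_cost N M r x0 \<theta> = (\<Sum>k=0..N. r k (forward M x0 \<theta> k, \<theta>))"

text \<open>For \<open>k > N\<close> the value of the next function is a meaningless dummy.\<close>

function adjoint_sol ::
  "nat \<Rightarrow> (nat \<Rightarrow> (real^'n) \<times> (real^'m) \<Rightarrow> real^'n) \<Rightarrow> (nat \<Rightarrow> (real^'n) \<times> (real^'m) \<Rightarrow> real)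
    \<Rightarrow> (real^'m \<Rightarrow> real^'n) \<Rightarrow> real^'m \<Rightarrow> nat \<Rightarrow> real^'n" where
  "adjoint_sol N M r x0 \<theta> k =
    (if k < N
     then transpose (model_x M k (forward M x0 \<theta> k) \<theta>) *v adjoint_sol N M r x0 \<theta> (Suc k)
          + cost_x r k (forward M x0 \<theta> k) \<theta>
     else cost_x r N (forward M x0 \<theta> N) \<theta>)"
  by pat_completeness auto
termination
  by (relation "Wellfounded.measure (\<lambda>(N, M, r, x0, \<theta>, k). N - k)") auto

declare adjoint_sol.simps [simp del]

definition super_lagrangian ::
  "nat \<Rightarrow> (nat \<Rightarrow> (real^'n) \<times> (real^'m) \<Rightarrow> real^'n) \<Rightarrow> (nat \<Rightarrow> (real^'n) \<times> (real^'m) \<Rightarrow> real)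
    \<Rightarrow> (real^'m \<Rightarrow> real^'n) \<Rightarrow> (real^'m \<Rightarrow> real) \<Rightarrow> real^'m \<Rightarrow> (nat \<Rightarrow> real^'n) \<Rightarrow> (nat \<Rightarrow> real^'n)
    \<Rightarrow> (nat \<Rightarrow> real^'n) \<Rightarrow> (nat \<Rightarrow> real^'n) \<Rightarrow> real^'m \<Rightarrow> real" where
  "super_lagrangian N M r x0 E \<theta> x l \<mu> \<nu> \<zeta> =
     E \<theta>
     - \<nu> 0 \<bullet> (x 0 - x0 \<theta>)
     - (\<Sum>k=0..<N. \<nu> (k+1) \<bullet> (x (k+1) - M k (x k, \<theta>)))
     - \<mu> N \<bullet> (l N - cost_x r N (x N) \<theta>)
     - (\<Sum>k=0..<N. \<mu> k \<bullet> (l k - transpose (model_x M k (x k) \<theta>) *v l (k+1) - cost_x r k (x k) \<theta>))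
     - \<zeta> \<bullet> (transpose (jacobian x0 (at \<theta>)) *v l 0
            + (\<Sum>k=0..N. cost_\<theta> r k (x k) \<theta>)
            + (\<Sum>k=0..<N. transpose (model_\<theta> M k (x k) \<theta>) *v l (k+1)))"

definition stationary_point ::
  "nat \<Rightarrow> (nat \<Rightarrow> (real^'n) \<times> (real^'m) \<Rightarrow> real^'n) \<Rightarrow> (nat \<Rightarrow> (real^'n) \<times> (real^'m) \<Rightarrow> real)
    \<Rightarrow> (real^'m \<Rightarrow> real^'n) \<Rightarrow> (real^'m \<Rightarrow> real) \<Rightarrow> real^'m \<Rightarrow> (nat \<Rightarrow> real^'n) \<Rightarrow> (nat \<Rightarrow> real^'n)
    \<Rightarrow> (nat \<Rightarrow> real^'n) \<Rightarrow> (nat \<Rightarrow> real^'n) \<Rightarrow> real^'m \<Rightarrow> bool" where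
  "stationary_point N M r x0 E \<theta> x l \<mu> \<nu> \<zeta> \<longleftrightarrow>
     partials_vanish (\<lambda>t. super_lagrangian N M r x0 E t x l \<mu> \<nu> \<zeta>) \<theta> \<and>
     (\<forall>k\<le>N. partials_vanish (\<lambda>y. super_lagrangian N M r x0 E \<theta> (x(k := y)) l \<mu> \<nu> \<zeta>) (x k)) \<and>
     (\<forall>k\<le>N. partials_vanish (\<lambda>y. super_lagrangian N M r x0 E \<theta> x (l(k := y)) \<mu> \<nu> \<zeta>) (l k)) \<and>
     (\<forall>k\<le>N. partials_vanish (\<lambda>y. super_lagrangian N M r x0 E \<theta> x l (\<mu>(k := y)) \<nu> \<zeta>) (\<mu> k)) \<and>
     (\<forall>k\<le>N. partials_vanish (\<lambda>y. super_lagrangian N M r x0 E \<theta> x l \<mu> (\<nu>(k := y)) \<zeta>) (\<nu> k)) \<and>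
     partials_vanish (\<lambda>z. super_lagrangian N M r x0 E \<theta> x l \<mu> \<nu> z) \<zeta>"

definition hessian_equation ::
  "nat \<Rightarrow> (nat \<Rightarrow> (real^'n) \<times> (real^'m) \<Rightarrow> real^'n) \<Rightarrow> (nat \<Rightarrow> (real^'n) \<times> (real^'m) \<Rightarrow> real)
    \<Rightarrow> (real^'m \<Rightarrow> real^'n) \<Rightarrow> (real^'m \<Rightarrow> real) \<Rightarrow> real^'m \<Rightarrow> real^'m \<Rightarrow> bool" where
  "hessian_equation N M r x0 E \<theta> \<zeta> \<longleftrightarrow>
     hessian (reduced_cost N M r x0) \<theta> *v \<zeta> = grad E \<theta>"

definition tangent_linear_model ::
  "nat \<Rightarrow> (nat \<Rightarrow> (real^'n) \<times> (real^'m) \<Rightarrow> real^'n) \<Rightarrow> (real^'m \<Rightarrow> real^'n) \<Rightarrow> real^'m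
    \<Rightarrow> (nat \<Rightarrow> real^'n) \<Rightarrow> real^'m \<Rightarrow> (nat \<Rightarrow> real^'n) \<Rightarrow> bool" where
  "tangent_linear_model N M x0 \<theta> x \<zeta> \<mu> \<longleftrightarrow>
     \<mu> 0 = - (jacobian x0 (at \<theta>) *v \<zeta>) \<and>
     (\<forall>k\<in>{1..N}. \<mu> k = model_x M (k-1) (x (k-1)) \<theta> *v \<mu> (k-1)
                       - model_\<theta> M (k-1) (x (k-1)) \<theta> *v \<zeta>)"

definition second_order_adjoint_model ::
  "nat \<Rightarrow> (nat \<Rightarrow> (real^'n) \<times> (real^'m) \<Rightarrow> real^'n) \<Rightarrow> (nat \<Rightarrow> (real^'n) \<times> (real^'m) \<Rightarrow> real)
    \<Rightarrow> real^'m \<Rightarrow> (nat \<Rightarrow> real^'n) \<Rightarrow> (nat \<Rightarrow> real^'n)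
    \<Rightarrow> real^'m \<Rightarrow> (nat \<Rightarrow> real^'n) \<Rightarrow> (nat \<Rightarrow> real^'n) \<Rightarrow> bool" where
  "second_order_adjoint_model N M r \<theta> x l \<zeta> \<mu> \<nu> \<longleftrightarrow>
     \<nu> N = cost_xx r N (x N) \<theta> *v \<mu> N - cost_\<theta>x r N (x N) \<theta> *v \<zeta> \<and>
     (\<forall>k<N. \<nu> k = transpose (model_x M k (x k) \<theta>) *v \<nu> (k+1)
                 + transpose (model_x_adj_x M k (x k) \<theta> (l (k+1))) *v \<mu> k
                 + cost_xx r k (x k) \<theta> *v \<mu> k
                 - cost_\<theta>x r k (x k) \<theta> *v \<zeta>
                 - transpose (model_\<theta>_adj_x M k (x k) \<theta> (l (k+1))) *v \<zeta>)"

definition computed_by_steps ::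
  "nat \<Rightarrow> (nat \<Rightarrow> (real^'n) \<times> (real^'m) \<Rightarrow> real^'n) \<Rightarrow> (nat \<Rightarrow> (real^'n) \<times> (real^'m) \<Rightarrow> real)
    \<Rightarrow> (real^'m \<Rightarrow> real^'n) \<Rightarrow> (real^'m \<Rightarrow> real) \<Rightarrow> real^'m \<Rightarrow> (nat \<Rightarrow> real^'n) \<Rightarrow> (nat \<Rightarrow> real^'n)
    \<Rightarrow> (nat \<Rightarrow> real^'n) \<Rightarrow> (nat \<Rightarrow> real^'n) \<Rightarrow> real^'m \<Rightarrow> bool" where
  "computed_by_steps N M r x0 E \<theta> x l \<mu> \<nu> \<zeta> \<longleftrightarrow>
     hessian_equation N M r x0 E \<theta> \<zeta> \<and>
     tangent_linear_model N M x0 \<theta> x \<zeta> \<mu> \<and>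
     second_order_adjoint_model N M r \<theta> x l \<zeta> \<mu> \<nu>"

end

(*
  Testing every equation against a vector v turns the matrix recursions into scalar identities
  between Frechet derivatives. At the forward and adjoint solutions the super-Lagrangian equals
  E - zeta . grad j for all mu, nu, zeta, so its derivatives in mu, nu and zeta vanish because
  grad j = 0 at the minimizer. Its derivatives in lambda and x vanish iff the tangent linear and
  second order adjoint models hold, and by symmetry of second derivatives these say that mu and
  nu are minus the derivatives of the forward and the adjoint solution in direction zeta.
  Differentiating the adjoint formula for grad j in direction zeta then identifies the derivative
  in theta as E_theta minus the Hessian of j applied to zeta. Since the Hessian is definite, the
  Hessian equation has exactly one solution.
*)
theory Submission
  imports Defs
begin

section \<open>Gradients, Jacobians and partial derivatives tested against vectors\<close>

lemma grad_inner:
  assumes "(f has_derivative f') (at x)"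
  shows "grad f x \<bullet> v = f' v"
proof -
  have lin: "linear f'"
    using assms by (rule has_derivative_linear)
  have "grad f x \<bullet> v = (\<Sum>i\<in>UNIV. v $ i * f' (axis i 1))"
    by (simp add: grad_def inner_vec_def frechet_derivative_at[OF assms, symmetric] mult.commute)
  also have "\<dots> = f' (\<Sum>i\<in>UNIV. v $ i *\<^sub>R axis i 1)"
    by (simp add: linear_sum[OF lin] linear_cmul[OF lin])
  finally show ?thesis
    by (simp add: basis_expansion flip: scalar_mult_eq_scaleR)
qed

lemma jacobian_apply:
  fixes f :: "real^'a \<Rightarrow> real^'b"
  assumes "(f has_derivative f') (at x)"
  shows "jacobian f (at x) *v v = f' v"
proof -
  have "(f has_derivative (\<lambda>h. jacobian f (at x) *v h)) (at x)"
    unfolding jacobian_works[symmetric] differentiable_def using assms by blast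
  from has_derivative_unique[OF this assms] show ?thesis by (rule fun_cong)
qed

text \<open>Testing against a vector moves a transposed matrix to the other factor. The simp rule
  \<open>transpose_matrix_vector\<close> would rewrite such a product first, so simp calls relying
  on this lemma delete it.\<close>

lemma transpose_inner: "(transpose A *v a) \<bullet> v = a \<bullet> (A *v (v :: real^'n))"
  by (simp add: transpose_matrix_vector dot_lmul_matrix)

text \<open>Stationarity speaks of coordinate lines only; a linear derivative that vanishes on the
  unit vectors vanishes everywhere.\<close>

lemma partials_vanish_iff:
  fixes F :: "real^'a \<Rightarrow> real"
  assumes "(F has_derivative F') (at x)"
  shows "partials_vanish F x \<longleftrightarrow> (\<forall>v. F' v = 0)"
proof -
  have lin: "linear F'"
    using assms by (rule has_derivative_linear)
  have line: "((\<lambda>t. F (x + t *\<^sub>R v)) has_real_derivative F' v) (at 0)" for v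
  proof -
    have "((\<lambda>t. F (x + t *\<^sub>R v)) has_derivative (\<lambda>t. F' (t *\<^sub>R v))) (at 0)"
      by (rule has_derivative_compose[where f="\<lambda>t. x + t *\<^sub>R v" and g=F])
        (auto intro!: derivative_eq_intros assms)
    then show ?thesis
      by (simp add: has_field_derivative_def linear_cmul[OF lin] mult_commute_abs)
  qed
  have "partials_vanish F x \<longleftrightarrow> (\<forall>i. F' (axis i 1) = 0)"
    unfolding partials_vanish_def using line by (metis DERIV_unique)
  also have "\<dots> \<longleftrightarrow> (\<forall>v. F' v = 0)"
  proof
    assume *: "\<forall>i. F' (axis i 1) = 0"
    show "\<forall>v. F' v = 0"
    proof
      fix v
      have "F' v = F' (\<Sum>i\<in>UNIV. v $ i *\<^sub>R axis i 1)"
        by (simp add: basis_expansion flip: scalar_mult_eq_scaleR)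
      also have "\<dots> = 0"
        by (simp add: linear_sum[OF lin] linear_cmul[OF lin] *)
      finally show "F' v = 0" .
    qed
  qed simp
  finally show ?thesis .
qed

text \<open>Bundled as a bounded linear map so that it can be differentiated again: in
  \<open>fderiv (fderiv f) z u v\<close> the direction \<open>u\<close> moves the base point and
  \<open>v\<close> is the argument of the first derivative.\<close>

definition fderiv :: "('a::real_normed_vector \<Rightarrow> 'b::real_normed_vector) \<Rightarrow> 'a \<Rightarrow> 'a \<Rightarrow>\<^sub>L 'b" where
  "fderiv f z = Blinfun (frechet_derivative f (at z))"

lemma fderiv_eqI:
  assumes "(f has_derivative blinfun_apply f') (at z)"
  shows "fderiv f z = f'"
  by (simp add: fderiv_def frechet_derivative_at[OF assms, symmetric] blinfun_apply_inverse)

text \<open>In a Euclidean space differentiability may be checked on components, which are inner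
  products with basis vectors. Scalar tests thus yield both the existence and the value of a
  vector-valued derivative.\<close>

lemma fderiv_of_inner:
  fixes G :: "'a::real_normed_vector \<Rightarrow> 'b::euclidean_space"
  assumes "\<And>v. ((\<lambda>z. G z \<bullet> v) has_derivative (\<lambda>u. B u v)) (at z)"
  shows "(G has_derivative fderiv G z) (at z)" and "fderiv G z u \<bullet> v = B u v"
proof -
  have "G differentiable (at z)"
    unfolding differentiable_componentwise_within[of G z UNIV]
    unfolding differentiable_def using assms by blast
  then obtain G' where G': "(G has_derivative G') (at z)"
    by (auto simp: differentiable_def)
  then have "G' = fderiv G z"
    by (simp add: fderiv_def frechet_derivative_at[OF G', symmetric] bounded_linear_Blinfun_apply
        has_derivative_bounded_linear)
  with G' show G'': "(G has_derivative fderiv G z) (at z)"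
    by simp
  show "fderiv G z u \<bullet> v = B u v"
    using fun_cong[OF has_derivative_unique[OF has_derivative_inner_left[OF G''] assms[of v]], of u] .
qed

lemma jacobian_inner:
  fixes G :: "real^'a \<Rightarrow> real^'b"
  assumes "\<And>v. ((\<lambda>z. G z \<bullet> v) has_derivative (\<lambda>u. B u v)) (at z)"
  shows "(jacobian G (at z) *v u) \<bullet> v = B u v"
  using fderiv_of_inner[where G=G, OF assms] by (metis jacobian_apply)

section \<open>Symmetry of second derivatives\<close>

lemma mvt_along_line:
  fixes f :: "'a::real_normed_vector \<Rightarrow> real"
  assumes "\<And>z. (f has_derivative f' z) (at z)" and "h > 0"
  obtains s where "0 < s" "s < h" "f (z + h *\<^sub>R u) - f z = h * f' (z + s *\<^sub>R u) u"
proof -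
  have "((\<lambda>s. f (z + s *\<^sub>R u)) has_derivative (\<lambda>t. t * f' (z + s *\<^sub>R u) u)) (at s)" for s
  proof -
    have "((\<lambda>s. f (z + s *\<^sub>R u)) has_derivative (\<lambda>t. f' (z + s *\<^sub>R u) (t *\<^sub>R u))) (at s)"
      by (rule has_derivative_compose[where f="\<lambda>s. z + s *\<^sub>R u" and g=f])
        (auto intro!: derivative_eq_intros assms)
    then show ?thesis
      by (simp add: linear_cmul[OF has_derivative_linear[OF assms(1)]])
  qed
  from mvt_simple[OF \<open>h > 0\<close> has_derivative_at_withinI[OF this]]
  show thesis using that by (auto simp: mult.commute)
qed

text \<open>The mean value theorem is used twice: along \<open>u\<close> for the increment of
  \<open>f\<close> under the shift by \<open>h *\<^sub>R v\<close>, then along \<open>v\<close> for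
  the derivative of \<open>f\<close> in direction \<open>u\<close>.\<close>

lemma second_difference:
  fixes f :: "'a::real_normed_vector \<Rightarrow> real"
  assumes f: "\<And>z. (f has_derivative f' z) (at z)"
    and f': "\<And>z w. ((\<lambda>z. f' z w) has_derivative (\<lambda>v. f'' z v w)) (at z)"
    and "h > 0"
  obtains s t where "0 < s" "s < h" "0 < t" "t < h"
    "f (z + h *\<^sub>R u + h *\<^sub>R v) - f (z + h *\<^sub>R u) - f (z + h *\<^sub>R v) + f z
       = h * h * f'' (z + s *\<^sub>R u + t *\<^sub>R v) v u"
proof -
  have "((\<lambda>y. f (y + h *\<^sub>R v) - f y) has_derivative (\<lambda>w. f' (y + h *\<^sub>R v) w - f' y w)) (at y)" for y
    by (intro has_derivative_diff f has_derivative_compose[where g=f, OF _ f, of "\<lambda>y. y + h *\<^sub>R v"])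
      (auto intro!: derivative_eq_intros)
  from mvt_along_line[OF this \<open>h > 0\<close>, of z u]
  obtain s where s: "0 < s" "s < h"
    and 1: "f (z + h *\<^sub>R u + h *\<^sub>R v) - f (z + h *\<^sub>R u) - (f (z + h *\<^sub>R v) - f z)
        = h * (f' (z + s *\<^sub>R u + h *\<^sub>R v) u - f' (z + s *\<^sub>R u) u)"
    by metis
  from mvt_along_line[where f="\<lambda>z. f' z u" and z="z + s *\<^sub>R u" and u=v, OF f' \<open>h > 0\<close>]
  obtain t where "0 < t" "t < h"
    "f' (z + s *\<^sub>R u + h *\<^sub>R v) u - f' (z + s *\<^sub>R u) u = h * f'' (z + s *\<^sub>R u + t *\<^sub>R v) v u"
    by metis
  with s 1 that show thesis by (auto simp: algebra_simps)
qed

text \<open>Both iterated derivatives are limits of the same symmetric second difference quotient.\<close>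

lemma second_derivative_symmetric:
  fixes f :: "'a::real_normed_vector \<Rightarrow> real"
  assumes f: "\<And>z. (f has_derivative f' z) (at z)"
    and f': "\<And>z w. ((\<lambda>z. f' z w) has_derivative (\<lambda>v. f'' z v w)) (at z)"
    and cont: "\<And>v w. continuous_on UNIV (\<lambda>z. f'' z v w)"
  shows "f'' x u v = f'' x v u"
proof -
  define \<Delta> where "\<Delta> h = (f (x + h *\<^sub>R u + h *\<^sub>R v) - f (x + h *\<^sub>R u) - f (x + h *\<^sub>R v) + f x) / (h * h)"
    for h
  \<comment> \<open>Both parameters are squeezed to 0, so the evaluation points tend to
    \<open>x\<close> and continuity of the second derivative applies.\<close>
  have lim: "(\<lambda>n. f'' (x + s n *\<^sub>R a + t n *\<^sub>R b) c d) \<longlonglongrightarrow> f'' x c d"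
    if s: "\<And>n. 0 < s n \<and> s n < inverse (real (Suc n))"
      and t: "\<And>n. 0 < t n \<and> t n < inverse (real (Suc n))" for s t a b c d
  proof -
    have "w \<longlonglongrightarrow> 0" if "\<And>n. 0 < w n \<and> w n < inverse (real (Suc n))" for w
      by (rule tendsto_sandwich[OF _ _ tendsto_const LIMSEQ_inverse_real_of_nat])
        (use that in \<open>auto intro!: always_eventually intro: less_imp_le simp del: of_nat_Suc\<close>)
    with s t have "s \<longlonglongrightarrow> 0" "t \<longlonglongrightarrow> 0"
      by blast+
    then have "(\<lambda>n. x + s n *\<^sub>R a + t n *\<^sub>R b) \<longlonglongrightarrow> x + 0 *\<^sub>R a + 0 *\<^sub>R b"
      by (intro tendsto_intros)
    from continuous_on_tendsto_compose[OF cont this] show ?thesis by simp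
  qed
  have "\<exists>s t. 0 < s \<and> s < inverse (real (Suc n)) \<and> 0 < t \<and> t < inverse (real (Suc n)) \<and>
     \<Delta> (inverse (real (Suc n))) = f'' (x + s *\<^sub>R u + t *\<^sub>R v) v u" for n
  proof -
    let ?h = "inverse (real (Suc n))"
    have "?h > 0" by simp
    from second_difference[OF f f' this, of x u v] obtain s t where "0 < s" "s < ?h" "0 < t" "t < ?h"
      "f (x + ?h *\<^sub>R u + ?h *\<^sub>R v) - f (x + ?h *\<^sub>R u) - f (x + ?h *\<^sub>R v) + f x
       = ?h * ?h * f'' (x + s *\<^sub>R u + t *\<^sub>R v) v u" .
    moreover from this(5) have "\<Delta> ?h = f'' (x + s *\<^sub>R u + t *\<^sub>R v) v u"
      using \<open>?h > 0\<close> unfolding \<Delta>_def by (simp del: of_nat_Suc)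
    ultimately show ?thesis by blast
  qed
  then obtain s t where "\<And>n. 0 < s n \<and> s n < inverse (real (Suc n))"
      "\<And>n. 0 < t n \<and> t n < inverse (real (Suc n))"
    and 1: "\<And>n. \<Delta> (inverse (real (Suc n))) = f'' (x + s n *\<^sub>R u + t n *\<^sub>R v) v u"
    by metis
  then have lim_vu: "(\<lambda>n. \<Delta> (inverse (real (Suc n)))) \<longlonglongrightarrow> f'' x v u"
    unfolding 1 by (intro lim)
  \<comment> \<open>Exchanging \<open>u\<close> and \<open>v\<close> only reorders the terms of the
    quotient \<open>\<Delta>\<close>, but expresses it through the other iterated
    derivative.\<close>
  have "\<exists>s t. 0 < s \<and> s < inverse (real (Suc n)) \<and> 0 < t \<and> t < inverse (real (Suc n)) \<and>
     \<Delta> (inverse (real (Suc n))) = f'' (x + s *\<^sub>R v + t *\<^sub>R u) u v" for n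
  proof -
    let ?h = "inverse (real (Suc n))"
    have "?h > 0" by simp
    from second_difference[OF f f' this, of x v u] obtain s t where "0 < s" "s < ?h" "0 < t" "t < ?h"
      "f (x + ?h *\<^sub>R v + ?h *\<^sub>R u) - f (x + ?h *\<^sub>R v) - f (x + ?h *\<^sub>R u) + f x
       = ?h * ?h * f'' (x + s *\<^sub>R v + t *\<^sub>R u) u v" .
    moreover from this(5) have "\<Delta> ?h = f'' (x + s *\<^sub>R v + t *\<^sub>R u) u v"
      using \<open>?h > 0\<close> unfolding \<Delta>_def add.assoc[of x] add.commute[of "?h *\<^sub>R u"]
        cancel_ab_semigroup_add_class.diff_right_commute[of _ "f (x + ?h *\<^sub>R u)"]
      by (simp del: of_nat_Suc)
    ultimately show ?thesis by blast
  qed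
  then obtain s t where "\<And>n. 0 < s n \<and> s n < inverse (real (Suc n))"
      "\<And>n. 0 < t n \<and> t n < inverse (real (Suc n))"
    and 2: "\<And>n. \<Delta> (inverse (real (Suc n))) = f'' (x + s n *\<^sub>R v + t n *\<^sub>R u) u v"
    by metis
  then have lim_uv: "(\<lambda>n. \<Delta> (inverse (real (Suc n)))) \<longlonglongrightarrow> f'' x u v"
    unfolding 2 by (intro lim)
  from LIMSEQ_unique[OF lim_uv lim_vu] show ?thesis .
qed

section \<open>Calculus of C1 and C2 maps\<close>

lemma C1_has_derivative: "C1 f \<Longrightarrow> (f has_derivative fderiv f z) (at z)"
  unfolding C1_def by (metis fderiv_eqI)

lemma C1_continuous_fderiv: "C1 f \<Longrightarrow> continuous_on UNIV (fderiv f)"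
  unfolding C1_def by (metis fderiv_eqI ext)

lemma C2_has_derivative: "C2 f \<Longrightarrow> (f has_derivative fderiv f z) (at z)"
  unfolding C2_def by (metis fderiv_eqI)

text \<open>Derivatives are unique, so the witness hidden in \<open>C2\<close> is
  \<open>fderiv f\<close> itself.\<close>

lemma C2_C1_fderiv:
  assumes "C2 f"
  shows "C1 (fderiv f)"
proof -
  obtain f' where f': "\<And>x. (f has_derivative blinfun_apply (f' x)) (at x)" "C1 f'"
    using assms unfolding C2_def by blast
  have "fderiv f = f'"
    using f'(1) fderiv_eqI by blast
  with f'(2) show ?thesis by simp
qed

lemmas C2_fderiv_has_derivative = C1_has_derivative[OF C2_C1_fderiv]

lemma C2_compose:
  assumes "C2 f" "(g has_derivative g') (at t)"
  shows "((\<lambda>t. f (g t)) has_derivative (\<lambda>w. fderiv f (g t) (g' w))) (at t)"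
  by (rule has_derivative_compose[OF assms(2) C2_has_derivative[OF assms(1)]])

text \<open>Evaluation at the fixed direction \<open>v\<close> is bounded linear, so it commutes
  with differentiation.\<close>

lemma C2_fderiv_compose:
  assumes "C2 f" "(g has_derivative g') (at t)"
  shows "((\<lambda>t. fderiv f (g t) v) has_derivative (\<lambda>w. fderiv (fderiv f) (g t) (g' w) v)) (at t)"
  using bounded_linear.has_derivative[OF blinfun.bounded_linear_left
      has_derivative_compose[OF assms(2) C2_fderiv_has_derivative[OF assms(1)]]] .

text \<open>Pairing with \<open>a\<close> reduces the claim to the scalar case.\<close>

lemma C2_symmetric:
  fixes f :: "'a::real_normed_vector \<Rightarrow> 'b::real_inner"
  assumes "C2 f"
  shows "a \<bullet> fderiv (fderiv f) z u v = a \<bullet> fderiv (fderiv f) z v u"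
proof (rule second_derivative_symmetric[where f="\<lambda>z. a \<bullet> f z" and f'="\<lambda>z v. a \<bullet> fderiv f z v"])
  show "((\<lambda>z. a \<bullet> f z) has_derivative (\<lambda>v. a \<bullet> fderiv f z v)) (at z)" for z
    by (intro has_derivative_inner_right C2_has_derivative assms)
  show "((\<lambda>z. a \<bullet> fderiv f z w) has_derivative (\<lambda>v. a \<bullet> fderiv (fderiv f) z v w)) (at z)" for z w
    by (intro has_derivative_inner_right C2_fderiv_compose assms has_derivative_ident)
  show "continuous_on UNIV (\<lambda>z. a \<bullet> fderiv (fderiv f) z v w)" for v w
    by (intro continuous_intros C1_continuous_fderiv C2_C1_fderiv assms)
qed

lemma vec_eq_inner_iff: "(a :: real^'k) = b \<longleftrightarrow> (\<forall>v. a \<bullet> v = b \<bullet> v)"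
  by (rule vector_eq_rdot[symmetric])

section \<open>Model and cost derivatives as derivatives on the product space\<close>

lemma Pair_fst_has_derivative: "((\<lambda>y. (y, b)) has_derivative (\<lambda>v. (v, 0))) (at a)"
  by (auto intro!: derivative_eq_intros)

lemma Pair_snd_has_derivative: "((\<lambda>y. (a, y)) has_derivative (\<lambda>v. (0, v))) (at b)"
  by (auto intro!: derivative_eq_intros)

lemma blinfun_Pair_split: "blinfun_apply F (a, b) = F (a, 0) + F (0, b)"
  by (simp flip: blinfun.add_right)

lemma blinfun_Pair_minus: "blinfun_apply F (a, - b) = F (a, 0) - F (0, b)"
  by (simp flip: blinfun.diff_right)

lemma model_x_apply: "C2 (M k) \<Longrightarrow> model_x M k y \<theta> *v v = fderiv (M k) (y, \<theta>) (v, 0)"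
  unfolding model_x_def by (intro jacobian_apply C2_compose Pair_fst_has_derivative)

lemma model_\<theta>_apply: "C2 (M k) \<Longrightarrow> model_\<theta> M k y \<theta> *v v = fderiv (M k) (y, \<theta>) (0, v)"
  unfolding model_\<theta>_def by (intro jacobian_apply C2_compose Pair_snd_has_derivative)

lemma cost_x_inner: "C2 (r k) \<Longrightarrow> cost_x r k y \<theta> \<bullet> v = fderiv (r k) (y, \<theta>) (v, 0)"
  unfolding cost_x_def by (intro grad_inner C2_compose Pair_fst_has_derivative)

lemma cost_\<theta>_inner: "C2 (r k) \<Longrightarrow> cost_\<theta> r k y \<theta> \<bullet> v = fderiv (r k) (y, \<theta>) (0, v)"
  unfolding cost_\<theta>_def by (intro grad_inner C2_compose Pair_snd_has_derivative)

lemma cost_xx_inner: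
  assumes "C2 (r k)"
  shows "(cost_xx r k y \<theta> *v u) \<bullet> v = fderiv (fderiv (r k)) (y, \<theta>) (u, 0) (v, 0)"
  unfolding cost_xx_def hessian_def
  by (rule jacobian_inner, unfold cost_x_inner[of r k, OF assms, unfolded cost_x_def],
      intro C2_fderiv_compose assms Pair_fst_has_derivative)

text \<open>The transpose in \<open>cost_\<theta>x\<close> lets the test vector \<open>v\<close>
  move the state, while \<open>u\<close> is the parameter direction. In
  \<open>cost_xx_inner\<close>, by contrast, it is \<open>u\<close> that moves the state.\<close>

lemma cost_\<theta>x_inner:
  assumes "C2 (r k)"
  shows "(cost_\<theta>x r k y \<theta> *v u) \<bullet> v = fderiv (fderiv (r k)) (y, \<theta>) (v, 0) (0, u)"
  unfolding cost_\<theta>x_def transpose_inner inner_commute[of u]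
  by (rule jacobian_inner, unfold cost_\<theta>_inner[of r k, OF assms],
      intro C2_fderiv_compose assms Pair_fst_has_derivative)

lemma model_x_adj_x_transpose_inner:
  assumes "C2 (M k)"
  shows "(transpose (model_x_adj_x M k y \<theta> l) *v u) \<bullet> v = l \<bullet> fderiv (fderiv (M k)) (y, \<theta>) (v, 0) (u, 0)"
  unfolding model_x_adj_x_def transpose_inner inner_commute[of u]
  by (rule jacobian_inner, unfold transpose_inner model_x_apply[of M k, OF assms],
      intro has_derivative_inner_right C2_fderiv_compose assms Pair_fst_has_derivative)

lemma model_\<theta>_adj_x_transpose_inner:
  assumes "C2 (M k)"
  shows "(transpose (model_\<theta>_adj_x M k y \<theta> l) *v u) \<bullet> v = l \<bullet> fderiv (fderiv (M k)) (y, \<theta>) (v, 0) (0, u)"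
  unfolding model_\<theta>_adj_x_def transpose_inner inner_commute[of u]
  by (rule jacobian_inner, unfold transpose_inner model_\<theta>_apply[of M k, OF assms],
      intro has_derivative_inner_right C2_fderiv_compose assms Pair_fst_has_derivative)

text \<open>Only the summand with index \<open>k\<close> sees the updated entry. This gives the
  partial derivatives of sums with respect to a single entry of a trajectory.\<close>

lemma sum_fun_upd_has_derivative:
  assumes "finite A" and "k \<in> A \<Longrightarrow> (g k has_derivative g') (at a)"
  shows "((\<lambda>y. \<Sum>j\<in>A. g j ((x(k := y)) j)) has_derivative (\<lambda>v. if k \<in> A then g' v else 0)) (at a)"
proof -
  have split: "(\<Sum>j\<in>A. g j ((x(k := y)) j)) = (if k \<in> A then g k y else 0) + (\<Sum>j\<in>A - {k}. g j (x j))" for y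
  proof -
    have "(\<Sum>j\<in>A - {k}. g j ((x(k := y)) j)) = (\<Sum>j\<in>A - {k}. g j (x j))"
      by (rule sum.cong) auto
    then show ?thesis
      using sum.remove[OF assms(1), of k "\<lambda>j. g j ((x(k := y)) j)"] by (cases "k \<in> A") simp_all
  qed
  show ?thesis
    unfolding split using assms(2) by (cases "k \<in> A") (auto intro!: derivative_eq_intros)
qed

section \<open>Derivatives of the forward and adjoint solutions\<close>

primrec tangent ::
  "(nat \<Rightarrow> (real^'n) \<times> (real^'m) \<Rightarrow> real^'n) \<Rightarrow> (real^'m \<Rightarrow> real^'n) \<Rightarrow> real^'m \<Rightarrow> real^'m \<Rightarrow> nat \<Rightarrow> real^'n" where
  "tangent M x0 \<theta> v 0 = fderiv x0 \<theta> v"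
| "tangent M x0 \<theta> v (Suc k) = fderiv (M k) (forward M x0 \<theta> k, \<theta>) (tangent M x0 \<theta> v k, v)"

text \<open>The identities below are proved at every parameter because they are themselves
  differentiated in it; the minimizer enters only at the end.\<close>

locale smooth_model =
  fixes N :: nat
    and M :: "nat \<Rightarrow> (real^'n) \<times> (real^'m) \<Rightarrow> real^'n"
    and r :: "nat \<Rightarrow> (real^'n) \<times> (real^'m) \<Rightarrow> real"
    and x0 :: "real^'m \<Rightarrow> real^'n"
  assumes C2_M: "\<And>k. k < N \<Longrightarrow> C2 (M k)"
    and C2_r: "\<And>k. k \<le> N \<Longrightarrow> C2 (r k)"
    and C2_x0: "C2 x0"
begin

abbreviation "state \<equiv> forward M x0"
abbreviation "state' \<equiv> tangent M x0"
abbreviation "adj \<equiv> adjoint_sol N M r x0"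
abbreviation "adj' \<theta> v k \<equiv> fderiv (\<lambda>t. adj t k) \<theta> v"

text \<open>\<open>tangent\<close> is the forward recursion differentiated by the chain rule, with
  state and parameter moving together.\<close>

lemma state_has_derivative:
  "k \<le> N \<Longrightarrow> ((\<lambda>t. state t k) has_derivative (\<lambda>v. state' \<theta> v k)) (at \<theta>)"
proof (induction k)
  case 0
  then show ?case by (simp add: C2_has_derivative C2_x0)
next
  case (Suc k)
  then show ?case
    by (auto intro!: C2_compose[where f="M k" and g="\<lambda>t. (state t k, t)"] C2_M
        has_derivative_Pair has_derivative_ident)
qed

lemma state_pair_has_derivative:
  "k \<le> N \<Longrightarrow> ((\<lambda>t. (state t k, t)) has_derivative (\<lambda>v. (state' \<theta> v k, v))) (at \<theta>)"
  by (intro has_derivative_Pair has_derivative_ident state_has_derivative)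

lemma adj_N_inner: "adj \<theta> N \<bullet> v = fderiv (r N) (state \<theta> N, \<theta>) (v, 0)"
  by (subst adjoint_sol.simps) (simp add: cost_x_inner C2_r)

lemma adj_inner:
  "k < N \<Longrightarrow> adj \<theta> k \<bullet> v = adj \<theta> (Suc k) \<bullet> fderiv (M k) (state \<theta> k, \<theta>) (v, 0)
     + fderiv (r k) (state \<theta> k, \<theta>) (v, 0)"
  by (subst adjoint_sol.simps)
    (simp add: cost_x_inner C2_r inner_add_left transpose_inner model_x_apply C2_M
      del: transpose_matrix_vector)

lemma adj_N_inner_has_derivative:
  "((\<lambda>t. adj t N \<bullet> v) has_derivative
     (\<lambda>w. fderiv (fderiv (r N)) (state \<theta> N, \<theta>) (state' \<theta> w N, w) (v, 0))) (at \<theta>)"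
  unfolding adj_N_inner by (intro C2_fderiv_compose C2_r state_pair_has_derivative order_refl)

text \<open>Product rule for one step of the adjoint recursion. The derivative of the next adjoint
  state is a hypothesis, to be supplied by backward induction.\<close>

lemma adj_inner_has_derivative:
  assumes "k < N" and "((\<lambda>t. adj t (Suc k)) has_derivative L') (at \<theta>)"
  shows "((\<lambda>t. adj t k \<bullet> v) has_derivative
     (\<lambda>w. adj \<theta> (Suc k) \<bullet> fderiv (fderiv (M k)) (state \<theta> k, \<theta>) (state' \<theta> w k, w) (v, 0)
        + L' w \<bullet> fderiv (M k) (state \<theta> k, \<theta>) (v, 0)
        + fderiv (fderiv (r k)) (state \<theta> k, \<theta>) (state' \<theta> w k, w) (v, 0))) (at \<theta>)"
  unfolding adj_inner[OF assms(1)] using assms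
  by (intro has_derivative_add has_derivative_inner C2_fderiv_compose C2_r C2_M
      state_pair_has_derivative) auto

lemma adj_has_derivative:
  "k \<le> N \<Longrightarrow> ((\<lambda>t. adj t k) has_derivative fderiv (\<lambda>t. adj t k) \<theta>) (at \<theta>)"
proof (induction k rule: inc_induct)
  case base
  show ?case by (rule fderiv_of_inner[OF adj_N_inner_has_derivative])
next
  case (step k)
  show ?case by (rule fderiv_of_inner[OF adj_inner_has_derivative[OF step(2,3)]])
qed

lemma adj'_N_inner:
  "adj' \<theta> w N \<bullet> v = fderiv (fderiv (r N)) (state \<theta> N, \<theta>) (state' \<theta> w N, w) (v, 0)"
  by (rule fderiv_of_inner[OF adj_N_inner_has_derivative])

text \<open>This differentiated adjoint recursion is, up to sign and symmetry of second derivatives,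
  the second order adjoint model.\<close>

lemma adj'_inner:
  assumes "k < N"
  shows "adj' \<theta> w k \<bullet> v =
     adj \<theta> (Suc k) \<bullet> fderiv (fderiv (M k)) (state \<theta> k, \<theta>) (state' \<theta> w k, w) (v, 0)
   + adj' \<theta> w (Suc k) \<bullet> fderiv (M k) (state \<theta> k, \<theta>) (v, 0)
   + fderiv (fderiv (r k)) (state \<theta> k, \<theta>) (state' \<theta> w k, w) (v, 0)"
  using assms by (intro fderiv_of_inner[OF adj_inner_has_derivative] adj_has_derivative) auto

section \<open>Reduced gradient and reduced Hessian by the adjoint method\<close>

abbreviation "j \<equiv> reduced_cost N M r x0"

lemma reduced_cost_has_derivative:
  "(j has_derivative (\<lambda>v. \<Sum>k\<le>N. fderiv (r k) (state \<theta> k, \<theta>) (state' \<theta> v k, v))) (at \<theta>)"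
  unfolding reduced_cost_def atLeast0AtMost
  by (intro has_derivative_sum C2_compose C2_r state_pair_has_derivative) auto

text \<open>The adjoint recursion trades derivatives of the states for a telescoping sum of
  adjoint-tangent pairings, leaving only derivatives in the parameter.\<close>

lemma grad_reduced_cost_inner:
  "grad j \<theta> \<bullet> v = adj \<theta> 0 \<bullet> fderiv x0 \<theta> v + (\<Sum>k\<le>N. fderiv (r k) (state \<theta> k, \<theta>) (0, v))
     + (\<Sum>k<N. adj \<theta> (Suc k) \<bullet> fderiv (M k) (state \<theta> k, \<theta>) (0, v))"
proof -
  let ?t = "state' \<theta> v"
  \<comment> \<open>The adjoint recursion is tested against the tangent; the model derivative in the
    state is the next tangent minus the model derivative in the parameter.\<close>
  have *: "fderiv (r k) (state \<theta> k, \<theta>) (?t k, 0) =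
      (adj \<theta> k \<bullet> ?t k - adj \<theta> (Suc k) \<bullet> ?t (Suc k)) + adj \<theta> (Suc k) \<bullet> fderiv (M k) (state \<theta> k, \<theta>) (0, v)"
    if "k < N" for k
    using that by (simp add: adj_inner blinfun_Pair_split[of _ "?t k" v] inner_add_right)
  have "(\<Sum>k\<le>N. fderiv (r k) (state \<theta> k, \<theta>) (?t k, 0)) =
      (\<Sum>k<N. fderiv (r k) (state \<theta> k, \<theta>) (?t k, 0)) + adj \<theta> N \<bullet> ?t N"
    by (simp add: adj_N_inner flip: lessThan_Suc_atMost)
  also have "\<dots> = adj \<theta> 0 \<bullet> ?t 0 + (\<Sum>k<N. adj \<theta> (Suc k) \<bullet> fderiv (M k) (state \<theta> k, \<theta>) (0, v))"
    by (simp add: * sum.distrib sum_lessThan_telescope'[of "\<lambda>k. adj \<theta> k \<bullet> ?t k"] del: tangent.simps(2))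
  finally show ?thesis
    by (simp add: grad_inner[OF reduced_cost_has_derivative] blinfun_Pair_split[of _ "?t _" v] sum.distrib)
qed

text \<open>The adjoint formula for the gradient is differentiated in direction \<open>w\<close>
  with \<open>v\<close> fixed; parameter, state and adjoint all vary.\<close>

lemma hessian_reduced_cost_inner:
  "(hessian j \<theta> *v w) \<bullet> v =
     adj \<theta> 0 \<bullet> fderiv (fderiv x0) \<theta> w v + adj' \<theta> w 0 \<bullet> fderiv x0 \<theta> v
   + (\<Sum>k\<le>N. fderiv (fderiv (r k)) (state \<theta> k, \<theta>) (state' \<theta> w k, w) (0, v))
   + (\<Sum>k<N. adj \<theta> (Suc k) \<bullet> fderiv (fderiv (M k)) (state \<theta> k, \<theta>) (state' \<theta> w k, w) (0, v)
       + adj' \<theta> w (Suc k) \<bullet> fderiv (M k) (state \<theta> k, \<theta>) (0, v))"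
  unfolding hessian_def
  by (rule jacobian_inner, unfold grad_reduced_cost_inner,
      intro has_derivative_add has_derivative_inner has_derivative_sum C2_fderiv_compose C2_r C2_M
        C2_x0 has_derivative_ident state_pair_has_derivative adj_has_derivative) auto

section \<open>The super-Lagrangian regrouped and at the forward and adjoint solutions\<close>

lemma super_lagrangian_eq:
  "super_lagrangian N M r x0 E \<theta> x l \<mu> \<nu> \<zeta> =
     E \<theta> + \<nu> 0 \<bullet> x0 \<theta> - l 0 \<bullet> fderiv x0 \<theta> \<zeta>
   + (\<Sum>k<N. \<nu> (Suc k) \<bullet> M k (x k, \<theta>) + l (Suc k) \<bullet> fderiv (M k) (x k, \<theta>) (\<mu> k, - \<zeta>))
   + (\<Sum>k\<le>N. fderiv (r k) (x k, \<theta>) (\<mu> k, - \<zeta>) - \<nu> k \<bullet> x k - \<mu> k \<bullet> l k)"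
proof -
  have x0': "\<zeta> \<bullet> (transpose (jacobian x0 (at \<theta>)) *v a) = a \<bullet> fderiv x0 \<theta> \<zeta>" for a
    by (simp add: inner_commute[of \<zeta>] transpose_inner jacobian_apply[OF C2_has_derivative[OF C2_x0]]
        del: transpose_matrix_vector)
  have M': "b \<bullet> (transpose (model_x M k (x k) \<theta>) *v a) = a \<bullet> fderiv (M k) (x k, \<theta>) (b, 0)"
    "\<zeta> \<bullet> (transpose (model_\<theta> M k (x k) \<theta>) *v a) = a \<bullet> fderiv (M k) (x k, \<theta>) (0, \<zeta>)" if "k < N" for k a b
    using that by (simp_all add: inner_commute[of b] inner_commute[of \<zeta>] transpose_inner
        model_x_apply model_\<theta>_apply C2_M del: transpose_matrix_vector)
  have r': "b \<bullet> cost_x r k (x k) \<theta> = fderiv (r k) (x k, \<theta>) (b, 0)"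
    "\<zeta> \<bullet> cost_\<theta> r k (x k) \<theta> = fderiv (r k) (x k, \<theta>) (0, \<zeta>)" if "k \<le> N" for k b
    using that by (simp_all add: inner_commute[of b] inner_commute[of \<zeta>] cost_x_inner cost_\<theta>_inner C2_r)
  \<comment> \<open>\<open>shift\<close> absorbs the separate initial term with
    \<open>\<nu> 0\<close>, \<open>last\<close> the separate terminal terms with
    \<open>\<mu> N\<close>. The state and parameter derivatives then merge into direction
    \<open>(\<mu> k, - \<zeta>)\<close>.\<close>
  have shift: "(\<Sum>k\<le>N. f k) = f 0 + (\<Sum>k<N. f (Suc k))" for f :: "nat \<Rightarrow> real"
    unfolding lessThan_Suc_atMost[symmetric] by (rule sum.lessThan_Suc_shift)
  have last: "(\<Sum>k\<le>N. f k) = (\<Sum>k<N. f k) + f N" for f :: "nat \<Rightarrow> real"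
    by (simp flip: lessThan_Suc_atMost)
  show ?thesis
    unfolding super_lagrangian_def atLeast0LessThan atLeast0AtMost
    by (simp add: inner_diff_right inner_add_right inner_sum_right x0' M' r' blinfun_Pair_minus
        sum.distrib sum_subtractf shift[of "\<lambda>k. \<nu> k \<bullet> x k"] last[of "\<lambda>k. \<mu> k \<bullet> l k"]
        last[of "\<lambda>k. fderiv (r k) (x k, \<theta>) (\<mu> k, 0)"]
        del: transpose_matrix_vector)
qed

text \<open>The right-hand side is exactly the bracket paired with \<open>\<zeta>\<close> in the
  super-Lagrangian.\<close>

lemma grad_reduced_cost:
  "grad j \<theta> = transpose (jacobian x0 (at \<theta>)) *v adj \<theta> 0
     + (\<Sum>k=0..N. cost_\<theta> r k (state \<theta> k) \<theta>)
     + (\<Sum>k=0..<N. transpose (model_\<theta> M k (state \<theta> k) \<theta>) *v adj \<theta> (k + 1))"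
  unfolding vec_eq_inner_iff atLeast0LessThan atLeast0AtMost
  by (simp add: grad_reduced_cost_inner inner_add_left inner_sum_left transpose_inner cost_\<theta>_inner
      C2_r C2_M model_\<theta>_apply jacobian_apply[OF C2_has_derivative[OF C2_x0]]
      del: transpose_matrix_vector)

text \<open>The brackets multiplied by \<open>\<nu>\<close> and \<open>\<mu>\<close> are the
  residuals of the forward and adjoint equations, so they vanish.\<close>

lemma super_lagrangian_on_shell:
  "super_lagrangian N M r x0 E \<theta> (state \<theta>) (adj \<theta>) \<mu> \<nu> \<zeta> = E \<theta> - \<zeta> \<bullet> grad j \<theta>"
proof -
  have N: "adj \<theta> N - cost_x r N (state \<theta> N) \<theta> = 0"
    by (subst adjoint_sol.simps) simp
  have k: "adj \<theta> k - transpose (model_x M k (state \<theta> k) \<theta>) *v adj \<theta> (Suc k)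
      - cost_x r k (state \<theta> k) \<theta> = 0" if "k < N" for k
    using that by (subst adjoint_sol.simps) simp
  show ?thesis
    unfolding super_lagrangian_def grad_reduced_cost[symmetric] by (simp add: N k del: transpose_matrix_vector)
qed

section \<open>Solutions of the tangent linear and second order adjoint models\<close>

definition tlm_rhs :: "real^'m \<Rightarrow> (nat \<Rightarrow> real^'n) \<Rightarrow> real^'m \<Rightarrow> (nat \<Rightarrow> real^'n) \<Rightarrow> nat \<Rightarrow> real^'n" where
  "tlm_rhs \<theta> x \<zeta> \<mu> k =
     (case k of 0 \<Rightarrow> - fderiv x0 \<theta> \<zeta> | Suc i \<Rightarrow> fderiv (M i) (x i, \<theta>) (\<mu> i, - \<zeta>))"

lemma tangent_linear_model_iff:
  "tangent_linear_model N M x0 \<theta> x \<zeta> \<mu> \<longleftrightarrow> (\<forall>k\<le>N. \<mu> k = tlm_rhs \<theta> x \<zeta> \<mu> k)"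
proof -
  have "(\<forall>k\<in>{1..N}. P k) \<longleftrightarrow> (\<forall>k<N. P (Suc k))" "(\<forall>k\<le>N. P k) \<longleftrightarrow> P 0 \<and> (\<forall>k<N. P (Suc k))" for P
    by (auto simp: Suc_le_eq gr0_conv_Suc) (metis Suc_le_eq not0_implies_Suc)
  then show ?thesis
    by (simp add: tangent_linear_model_def tlm_rhs_def model_x_apply model_\<theta>_apply C2_M
        blinfun_Pair_minus jacobian_apply[OF C2_has_derivative[OF C2_x0]])
qed

text \<open>By linearity, the negated tangent in direction \<open>\<zeta>\<close> solves the same
  recursion, and the initial value determines the solution.\<close>

lemma tangent_linear_model_state_iff:
  "tangent_linear_model N M x0 \<theta> (state \<theta>) \<zeta> \<mu> \<longleftrightarrow> (\<forall>k\<le>N. \<mu> k = - state' \<theta> \<zeta> k)"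
proof -
  have "tlm_rhs \<theta> (state \<theta>) \<zeta> \<mu> 0 = - state' \<theta> \<zeta> 0"
    by (simp add: tlm_rhs_def)
  moreover have "tlm_rhs \<theta> (state \<theta>) \<zeta> \<mu> (Suc k) = - state' \<theta> \<zeta> (Suc k)" if "\<mu> k = - state' \<theta> \<zeta> k" for k
    using that by (simp add: tlm_rhs_def flip: blinfun.minus_right)
  ultimately have step: "tlm_rhs \<theta> (state \<theta>) \<zeta> \<mu> k = - state' \<theta> \<zeta> k"
    if "\<And>i. i < k \<Longrightarrow> \<mu> i = - state' \<theta> \<zeta> i" for k
    using that by (cases k) auto
  show ?thesis
    unfolding tangent_linear_model_iff
  proof (intro iffI allI impI)
    fix k
    assume *: "\<forall>k\<le>N. \<mu> k = tlm_rhs \<theta> (state \<theta>) \<zeta> \<mu> k" and "k \<le> N"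
    from \<open>k \<le> N\<close> show "\<mu> k = - state' \<theta> \<zeta> k"
    proof (induction k rule: less_induct)
      case (less k)
      then have "tlm_rhs \<theta> (state \<theta>) \<zeta> \<mu> k = - state' \<theta> \<zeta> k"
        by (intro step) simp
      with * less.prems show ?case by simp
    qed
  qed (simp add: step)
qed

text \<open>The right-hand side of the second order adjoint model, tested against \<open>v\<close>.
  The value 0 at \<open>k = N\<close> removes the model terms, so the terminal condition is
  included.\<close>

definition soa_rhs ::
  "real^'m \<Rightarrow> (nat \<Rightarrow> real^'n) \<Rightarrow> (nat \<Rightarrow> real^'n) \<Rightarrow> real^'m \<Rightarrow> (nat \<Rightarrow> real^'n) \<Rightarrow> (nat \<Rightarrow> real^'n)
    \<Rightarrow> nat \<Rightarrow> real^'n \<Rightarrow> real" where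
  "soa_rhs \<theta> x l \<zeta> \<mu> \<nu> k v =
     (if k < N then \<nu> (Suc k) \<bullet> fderiv (M k) (x k, \<theta>) (v, 0)
        + l (Suc k) \<bullet> fderiv (fderiv (M k)) (x k, \<theta>) (v, 0) (\<mu> k, - \<zeta>) else 0)
     + fderiv (fderiv (r k)) (x k, \<theta>) (v, 0) (\<mu> k, - \<zeta>)"

lemma second_order_adjoint_model_iff:
  "second_order_adjoint_model N M r \<theta> x l \<zeta> \<mu> \<nu> \<longleftrightarrow> (\<forall>k\<le>N. \<forall>v. \<nu> k \<bullet> v = soa_rhs \<theta> x l \<zeta> \<mu> \<nu> k v)"
proof -
  have last: "(\<forall>k\<le>N. P k) \<longleftrightarrow> P N \<and> (\<forall>k<N. P k)" for P
    by (auto simp: order_le_less)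
  \<comment> \<open>Symmetry brings \<open>v\<close> into the outer slot, where the other second
    derivative terms already have it.\<close>
  have xx: "(cost_xx r k (x k) \<theta> *v \<mu> k) \<bullet> v = fderiv (fderiv (r k)) (x k, \<theta>) (v, 0) (\<mu> k, 0)"
    if "k \<le> N" for k v
    using that C2_symmetric[of "r k" 1 "(x k, \<theta>)" "(\<mu> k, 0)" "(v, 0)"] by (simp add: cost_xx_inner C2_r)
  show ?thesis
    unfolding second_order_adjoint_model_def last vec_eq_inner_iff
    by (simp add: soa_rhs_def xx inner_add_left inner_diff_left inner_diff_right cost_\<theta>x_inner C2_r C2_M
        transpose_inner[of "model_x M _ _ _"] model_x_apply model_x_adj_x_transpose_inner
        model_\<theta>_adj_x_transpose_inner blinfun_Pair_minus algebra_simps del: transpose_matrix_vector)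
qed

text \<open>Linearity extracts the sign, and symmetry moves the tangent direction into the outer
  slot, where differentiation along the solution puts it.\<close>

lemma fderiv2_tangent:
  fixes f :: "(real^'n) \<times> (real^'m) \<Rightarrow> 'b::real_inner"
  assumes "C2 f"
  shows "a \<bullet> fderiv (fderiv f) z w (- t, - \<zeta>) = - (a \<bullet> fderiv (fderiv f) z (t, \<zeta>) w)"
proof -
  have "fderiv (fderiv f) z w (- t, - \<zeta>) = - fderiv (fderiv f) z w (t, \<zeta>)"
    by (simp flip: blinfun.minus_right)
  then show ?thesis
    by (simp add: C2_symmetric[OF assms, of a z w])
qed

lemmas fderiv2_tangent_real = fderiv2_tangent[where a = "1::real", simplified]

text \<open>After \<open>fderiv2_tangent\<close> the terms are those of the differentiated adjoint
  recursion with the opposite sign. Only the next \<open>\<nu>\<close> is presupposed, as backward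
  induction requires.\<close>

lemma soa_rhs_state:
  assumes "k \<le> N" and "\<mu> k = - state' \<theta> \<zeta> k" and "k < N \<Longrightarrow> \<nu> (Suc k) = - adj' \<theta> \<zeta> (Suc k)"
  shows "soa_rhs \<theta> (state \<theta>) (adj \<theta>) \<zeta> \<mu> \<nu> k v = - adj' \<theta> \<zeta> k \<bullet> v"
proof (cases "k < N")
  case True
  with assms show ?thesis
    by (simp add: soa_rhs_def adj'_inner fderiv2_tangent fderiv2_tangent_real C2_M C2_r)
next
  case False
  with assms(1) have "k = N" by simp
  with assms show ?thesis
    by (simp add: soa_rhs_def adj'_N_inner fderiv2_tangent_real C2_r)
qed

lemma second_order_adjoint_model_state_iff:
  assumes \<mu>: "\<forall>k\<le>N. \<mu> k = - state' \<theta> \<zeta> k"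
  shows "second_order_adjoint_model N M r \<theta> (state \<theta>) (adj \<theta>) \<zeta> \<mu> \<nu> \<longleftrightarrow> (\<forall>k\<le>N. \<nu> k = - adj' \<theta> \<zeta> k)"
  unfolding second_order_adjoint_model_iff
proof (intro iffI allI impI)
  fix k
  assume *: "\<forall>k\<le>N. \<forall>v. \<nu> k \<bullet> v = soa_rhs \<theta> (state \<theta>) (adj \<theta>) \<zeta> \<mu> \<nu> k v" and "k \<le> N"
  from \<open>k \<le> N\<close> show "\<nu> k = - adj' \<theta> \<zeta> k"
  \<comment> \<open>Backward from \<open>N\<close>, where the terminal condition fixes
    \<open>\<nu> N\<close>.\<close>
  proof (induction k rule: inc_induct)
    case base
    show ?case
      unfolding vec_eq_inner_iff using * soa_rhs_state[of N \<mu>] \<mu> by simp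
  next
    case (step k)
    then have "\<nu> k \<bullet> v = - adj' \<theta> \<zeta> k \<bullet> v" for v
      using * \<mu> by (simp add: soa_rhs_state)
    then show ?case
      by (simp add: vec_eq_inner_iff)
  qed
qed (simp add: soa_rhs_state \<mu>)

section \<open>Partial derivatives of the super-Lagrangian\<close>

lemma super_lagrangian_collect_adjoint:
  "super_lagrangian N M r x0 E \<theta> x l \<mu> \<nu> \<zeta> =
     E \<theta> + \<nu> 0 \<bullet> x0 \<theta> + (\<Sum>k<N. \<nu> (Suc k) \<bullet> M k (x k, \<theta>))
   + (\<Sum>k\<le>N. fderiv (r k) (x k, \<theta>) (\<mu> k, - \<zeta>) - \<nu> k \<bullet> x k)
   + (\<Sum>k\<le>N. l k \<bullet> (tlm_rhs \<theta> x \<zeta> \<mu> k - \<mu> k))"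
proof -
  have "(\<Sum>k\<le>N. l k \<bullet> tlm_rhs \<theta> x \<zeta> \<mu> k)
      = (\<Sum>k<N. l (Suc k) \<bullet> fderiv (M k) (x k, \<theta>) (\<mu> k, - \<zeta>)) - l 0 \<bullet> fderiv x0 \<theta> \<zeta>"
    unfolding lessThan_Suc_atMost[symmetric] sum.lessThan_Suc_shift by (simp add: tlm_rhs_def)
  then show ?thesis
    by (simp add: super_lagrangian_eq inner_diff_right sum.distrib sum_subtractf inner_commute[of "\<mu> _"])
qed

text \<open>The super-Lagrangian is affine in \<open>l\<close>; the coefficient of
  \<open>l k\<close> is the residual of the tangent linear model at \<open>k\<close>.\<close>

lemma partials_vanish_adjoint_iff:
  assumes "k \<le> N"
  shows "partials_vanish (\<lambda>y. super_lagrangian N M r x0 E \<theta> x (l(k := y)) \<mu> \<nu> \<zeta>) (l k)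
    \<longleftrightarrow> \<mu> k = tlm_rhs \<theta> x \<zeta> \<mu> k"
proof -
  have deriv: "((\<lambda>y. super_lagrangian N M r x0 E \<theta> x (l(k := y)) \<mu> \<nu> \<zeta>) has_derivative
      (\<lambda>v. 0 + (if k \<in> {..N} then v \<bullet> (tlm_rhs \<theta> x \<zeta> \<mu> k - \<mu> k) else 0))) (at (l k))"
    unfolding super_lagrangian_collect_adjoint
    by (intro has_derivative_add has_derivative_const has_derivative_inner_left has_derivative_ident
        sum_fun_upd_has_derivative[where g = "\<lambda>k y. y \<bullet> (tlm_rhs \<theta> x \<zeta> \<mu> k - \<mu> k)"] finite_atMost)
  have "(\<forall>v. v \<bullet> d = 0) \<longleftrightarrow> d = 0" for d :: "real^'n"
    by (auto dest: spec[of _ d])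
  with partials_vanish_iff[OF deriv] show ?thesis
    using assms by auto
qed

text \<open>In the regrouped form \<open>x k\<close> occurs only in the summands of index
  \<open>k\<close>, and the model summand is present only for \<open>k < N\<close>, which matches
  \<open>soa_rhs\<close>.\<close>

lemma partials_vanish_state_iff:
  assumes "k \<le> N"
  shows "partials_vanish (\<lambda>y. super_lagrangian N M r x0 E \<theta> (x(k := y)) l \<mu> \<nu> \<zeta>) (x k)
    \<longleftrightarrow> (\<forall>v. \<nu> k \<bullet> v = soa_rhs \<theta> x l \<zeta> \<mu> \<nu> k v)"
proof -
  have "((\<lambda>y. super_lagrangian N M r x0 E \<theta> (x(k := y)) l \<mu> \<nu> \<zeta>) has_derivative
      (\<lambda>v. 0 + (if k \<in> {..<N} then \<nu> (Suc k) \<bullet> fderiv (M k) (x k, \<theta>) (v, 0)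
            + l (Suc k) \<bullet> fderiv (fderiv (M k)) (x k, \<theta>) (v, 0) (\<mu> k, - \<zeta>) else 0)
          + (if k \<in> {..N} then fderiv (fderiv (r k)) (x k, \<theta>) (v, 0) (\<mu> k, - \<zeta>) - \<nu> k \<bullet> v - 0 else 0)))
      (at (x k))"
    unfolding super_lagrangian_eq
    by (intro has_derivative_add has_derivative_diff has_derivative_const has_derivative_inner_right
        has_derivative_ident finite_atMost finite_lessThan C2_fderiv_compose C2_compose[OF C2_M]
        C2_M C2_r Pair_fst_has_derivative
        sum_fun_upd_has_derivative[where g = "\<lambda>k y. \<nu> (Suc k) \<bullet> M k (y, \<theta>)
          + l (Suc k) \<bullet> fderiv (M k) (y, \<theta>) (\<mu> k, - \<zeta>)"]
        sum_fun_upd_has_derivative[where g = "\<lambda>k y. fderiv (r k) (y, \<theta>) (\<mu> k, - \<zeta>) - \<nu> k \<bullet> y - \<mu> k \<bullet> l k"])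
      auto
  from partials_vanish_iff[OF this] show ?thesis
    using assms by (auto simp: soa_rhs_def algebra_simps)
qed

text \<open>State and adjoint are frozen while the parameter varies; their missing variation
  re-enters through the multipliers, which are minus the derivatives of these solutions.\<close>

lemma partials_vanish_parameter_iff:
  assumes "C1 E" and \<mu>: "\<forall>k\<le>N. \<mu> k = - state' \<theta> \<zeta> k" and \<nu>: "\<forall>k\<le>N. \<nu> k = - adj' \<theta> \<zeta> k"
  shows "partials_vanish (\<lambda>t. super_lagrangian N M r x0 E t (state \<theta>) (adj \<theta>) \<mu> \<nu> \<zeta>) \<theta>
    \<longleftrightarrow> hessian_equation N M r x0 E \<theta> \<zeta>"
proof -
  let ?x = "state \<theta>" and ?l = "adj \<theta>"
  let ?L' = "\<lambda>v. fderiv E \<theta> v + \<nu> 0 \<bullet> fderiv x0 \<theta> v - ?l 0 \<bullet> fderiv (fderiv x0) \<theta> v \<zeta>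
      + (\<Sum>k<N. \<nu> (Suc k) \<bullet> fderiv (M k) (?x k, \<theta>) (0, v)
          + ?l (Suc k) \<bullet> fderiv (fderiv (M k)) (?x k, \<theta>) (0, v) (\<mu> k, - \<zeta>))
      + (\<Sum>k\<le>N. fderiv (fderiv (r k)) (?x k, \<theta>) (0, v) (\<mu> k, - \<zeta>) - 0 - 0)"
  have L': "((\<lambda>t. super_lagrangian N M r x0 E t ?x ?l \<mu> \<nu> \<zeta>) has_derivative ?L') (at \<theta>)"
    unfolding super_lagrangian_eq
    by (intro has_derivative_add has_derivative_diff has_derivative_const has_derivative_inner_right
        has_derivative_ident has_derivative_sum C1_has_derivative[OF assms(1)] C2_has_derivative[OF C2_x0]
        C2_fderiv_compose C2_compose[OF C2_M] C2_M C2_r C2_x0 Pair_snd_has_derivative) auto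
  \<comment> \<open>After symmetry of second derivatives, each term apart from that of
    \<open>E\<close> is minus a term of the Hessian formula.\<close>
  have "?L' v = grad E \<theta> \<bullet> v - (hessian j \<theta> *v \<zeta>) \<bullet> v" for v
    by (simp add: grad_inner[OF C1_has_derivative[OF assms(1)]] hessian_reduced_cost_inner \<mu> \<nu> C2_M C2_r
        fderiv2_tangent fderiv2_tangent_real C2_symmetric[OF C2_x0, of _ _ v] sum.distrib sum_subtractf sum_negf)
  then show ?thesis
    unfolding partials_vanish_iff[OF L'] hessian_equation_def vec_eq_inner_iff by auto
qed

section \<open>Stationary points and unique solvability of the three steps\<close>

lemma computed_by_steps_iff:
  "computed_by_steps N M r x0 E \<theta> (state \<theta>) (adj \<theta>) \<mu> \<nu> \<zeta> \<longleftrightarrow> hessian j \<theta> *v \<zeta> = grad E \<theta> \<and>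
     (\<forall>k\<le>N. \<mu> k = - state' \<theta> \<zeta> k) \<and> (\<forall>k\<le>N. \<nu> k = - adj' \<theta> \<zeta> k)"
  unfolding computed_by_steps_def hessian_equation_def tangent_linear_model_state_iff
  \<comment> \<open>\<open>conj_cong\<close> makes the formula for \<open>\<mu>\<close> available
    when the second order adjoint model is rewritten.\<close>
  by (simp add: second_order_adjoint_model_state_iff cong: conj_cong)

lemma stationary_point_iff:
  assumes "C1 E" and "grad j \<theta> = 0"
  shows "stationary_point N M r x0 E \<theta> (state \<theta>) (adj \<theta>) \<mu> \<nu> \<zeta>
    \<longleftrightarrow> computed_by_steps N M r x0 E \<theta> (state \<theta>) (adj \<theta>) \<mu> \<nu> \<zeta>"
proof -
  have const: "partials_vanish (\<lambda>_ :: real^'b. c) a" for c and a :: "real^'b"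
    by (simp add: partials_vanish_def)
  \<comment> \<open>Since the gradient vanishes, the value is constant in all three multipliers,
    which settles their stationarity conditions.\<close>
  have on_shell_const: "super_lagrangian N M r x0 E \<theta> (state \<theta>) (adj \<theta>) \<mu> \<nu> = (\<lambda>_. E \<theta>)"
    by (simp add: fun_eq_iff super_lagrangian_on_shell assms(2))
  have "stationary_point N M r x0 E \<theta> (state \<theta>) (adj \<theta>) \<mu> \<nu> \<zeta> \<longleftrightarrow>
      partials_vanish (\<lambda>t. super_lagrangian N M r x0 E t (state \<theta>) (adj \<theta>) \<mu> \<nu> \<zeta>) \<theta> \<and>
      second_order_adjoint_model N M r \<theta> (state \<theta>) (adj \<theta>) \<zeta> \<mu> \<nu> \<and>
      tangent_linear_model N M x0 \<theta> (state \<theta>) \<zeta> \<mu>"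
    unfolding stationary_point_def
    by (simp add: on_shell_const super_lagrangian_on_shell assms(2) const partials_vanish_adjoint_iff
        partials_vanish_state_iff tangent_linear_model_iff second_order_adjoint_model_iff)
  also have "\<dots> \<longleftrightarrow> hessian_equation N M r x0 E \<theta> \<zeta> \<and>
      (\<forall>k\<le>N. \<mu> k = - state' \<theta> \<zeta> k) \<and> (\<forall>k\<le>N. \<nu> k = - adj' \<theta> \<zeta> k)" (is "?P \<and> ?S \<and> ?T \<longleftrightarrow> _")
  \<comment> \<open>The derivative in the parameter is identified only once \<open>\<mu>\<close> is
    known; if the tangent linear model fails, both sides are false.\<close>
  proof (cases ?T)
    case True
    then have \<mu>: "\<forall>k\<le>N. \<mu> k = - state' \<theta> \<zeta> k"
      by (simp only: tangent_linear_model_state_iff)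
    show ?thesis
      using True \<mu> partials_vanish_parameter_iff[OF assms(1) \<mu>, of \<nu>]
      unfolding second_order_adjoint_model_state_iff[OF \<mu>] by argo
  next
    case False
    then show ?thesis
      by (simp only: tangent_linear_model_state_iff) simp
  qed
  finally show ?thesis
    by (simp add: computed_by_steps_iff hessian_equation_def)
qed

lemma grad_reduced_cost_minimizer:
  assumes "\<And>t. j \<theta> \<le> j t"
  shows "grad j \<theta> = 0"
proof -
  note deriv = reduced_cost_has_derivative[of \<theta>]
  from differential_zero_maxmin[OF _ open_UNIV deriv] assms
  have "(\<lambda>v. grad j \<theta> \<bullet> v) = (\<lambda>v. 0)"
    unfolding grad_inner[OF deriv] by simp
  from fun_cong[OF this, of "grad j \<theta>"] show ?thesis
    by simp
qed

end

text \<open>A definite matrix has trivial kernel, and an injective linear endomorphism of a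
  finite-dimensional space is onto.\<close>

lemma positive_definite_ex1:
  fixes A :: "real^'a^'a"
  assumes "positive_definite A"
  shows "\<exists>!v. A *v v = b"
proof -
  have inj: "inj ((*v) A)"
  proof (rule injI, rule ccontr)
    fix u v assume "A *v u = A *v v" and "u \<noteq> v"
    then have "A *v (u - v) = 0" "u - v \<noteq> 0"
      by (simp_all add: matrix_vector_mult_diff_distrib)
    with assms show False
      unfolding positive_definite_def by (metis inner_zero_right less_irrefl)
  qed
  then have "surj ((*v) A)"
    by (intro linear_inj_imp_surj matrix_vector_mul_linear)
  with inj show ?thesis
    unfolding inj_def surj_def by (metis (no_types))
qed

text \<open>The second conjunct says that the steps produce exactly one result. Trajectories are
  compared only at \<open>k \<le> N\<close>, since later values carry no meaning.\<close>

theorem theorem2: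
  fixes N :: nat
    and M :: "nat \<Rightarrow> (real^'n) \<times> (real^'m) \<Rightarrow> real^'n"
    and r :: "nat \<Rightarrow> (real^'n) \<times> (real^'m) \<Rightarrow> real"
    and x0 :: "real^'m \<Rightarrow> real^'n"
    and E :: "real^'m \<Rightarrow> real"
    and \<theta>a :: "real^'m"
    and x l :: "nat \<Rightarrow> real^'n"
  assumes "N \<ge> 1"
    and "\<And>k. k < N \<Longrightarrow> C2 (M k)"
    and "\<And>k. k \<le> N \<Longrightarrow> C2 (r k)"
    and "C2 x0"
    and "C1 E"
    and minimizer: "\<And>\<theta>. reduced_cost N M r x0 \<theta>a \<le> reduced_cost N M r x0 \<theta>"
    and "positive_definite (hessian (reduced_cost N M r x0) \<theta>a)"
    and x_def: "x = forward M x0 \<theta>a"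
    and l_def: "l = adjoint_sol N M r x0 \<theta>a"
  shows "(\<forall>\<mu> \<nu> \<zeta>. stationary_point N M r x0 E \<theta>a x l \<mu> \<nu> \<zeta> \<longleftrightarrow>
                   computed_by_steps N M r x0 E \<theta>a x l \<mu> \<nu> \<zeta>)
       \<and> (\<exists>\<mu> \<nu> \<zeta>. computed_by_steps N M r x0 E \<theta>a x l \<mu> \<nu> \<zeta> \<and>
            (\<forall>\<mu>' \<nu>' \<zeta>'. computed_by_steps N M r x0 E \<theta>a x l \<mu>' \<nu>' \<zeta>' \<longrightarrow>
               \<zeta>' = \<zeta> \<and> (\<forall>k\<le>N. \<mu>' k = \<mu> k \<and> \<nu>' k = \<nu> k)))"
proof -
  interpret smooth_model N M r x0
    by unfold_locales (use assms in auto)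
  obtain \<zeta> where \<zeta>: "hessian j \<theta>a *v \<zeta> = grad E \<theta>a"
      "\<And>\<zeta>'. hessian j \<theta>a *v \<zeta>' = grad E \<theta>a \<Longrightarrow> \<zeta>' = \<zeta>"
    using positive_definite_ex1 assms(7) by metis
  \<comment> \<open>The witnesses are minus the derivatives of the forward and adjoint solutions in
    the direction solving the Hessian equation.\<close>
  have "computed_by_steps N M r x0 E \<theta>a x l (\<lambda>k. - state' \<theta>a \<zeta> k) (\<lambda>k. - adj' \<theta>a \<zeta> k) \<zeta>"
    by (simp add: x_def l_def computed_by_steps_iff \<zeta>)
  moreover have "\<zeta>' = \<zeta> \<and> (\<forall>k\<le>N. \<mu>' k = - state' \<theta>a \<zeta> k \<and> \<nu>' k = - adj' \<theta>a \<zeta> k)"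
    if "computed_by_steps N M r x0 E \<theta>a x l \<mu>' \<nu>' \<zeta>'" for \<mu>' \<nu>' \<zeta>'
    using that \<zeta>(2)[of \<zeta>'] by (simp add: x_def l_def computed_by_steps_iff)
  moreover have "stationary_point N M r x0 E \<theta>a x l \<mu> \<nu> \<zeta> \<longleftrightarrow>
      computed_by_steps N M r x0 E \<theta>a x l \<mu> \<nu> \<zeta>" for \<mu> \<nu> \<zeta>
    unfolding x_def l_def
    by (intro stationary_point_iff \<open>C1 E\<close> grad_reduced_cost_minimizer minimizer)
  ultimately show ?thesis
    by blast
qed

end
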